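(* Consider $\min_{x\in X} f(x)$ with $f$ convex and $(k,L,\delta)$-approximately piecewise smooth with associated pieces $\{X_i\}_{i=1}^k$. Let $\{x^t\}_{t\ge 0}$ be generated by the approximate bundle-level method apx-BL$(m,f^*,x^0)$ with number of cuts $m\ge k$, the optimal value $f^*$ and an initial point $x^0\in X$. Let $\{(x^{l_i},x^{r_i})\}$ be any $k$-matching pair sequence with respect to $\{X_i\}$, and let $\bar\kappa(N)$ and $\bar\sigma(N)$ be the corresponding statistics. Then: (a) If $f$ is convex, then for $N\ge1$, $$\min_{t\in\{1,\dots,N\}} f(x^t)-f^*\le \frac{L\,\bar\sigma(N)\,\bar\kappa(N)}{2N}\,\operatorname{dist}^2(x^0,X^* )+\delta.$$ (b) If moreover $f$ satisfies the quadratic growth condition with modulus $\mu>0$, then for $N\ge 1$, $$\operatorname{dist}^2(x^N,X^* )\le \Big(1+\frac1{\kappa(N)}\Big)^{-N} C\cdot\operatorname{dist}^2(x^0,X^* )+\frac{4\delta}{\mu},$$ $$\min_{t\in\{1,\dots,N\}} f(x^t)-f^*\le \Big(1+\frac1{\kappa(N)}\Big)^{-N} C\cdot[f(x^0)-f^*]+2e\delta,$$ where $C>0$ is an absolute constant and the effective condition number $\kappa(N)$ is given by $\kappa(N)=O(1)\big(\bar\sigma(N)\bar\kappa(N)L/\mu\big)$.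
   Context: Setting. $X\subseteq\mathbb{R}^n$ is closed and convex, $f:X\to\mathbb{R}$ is Lipschitz continuous and bounded below, $f^*=\min_{x\in X}f(x)$, and the set of minimizers $X^*$ is non-empty. $\|\cdot\|$ is the Euclidean norm and $\operatorname{dist}(x,X^* )=\inf_{y\in X^*}\|x-y\|$. $(k,L,\delta)$-approximately piecewise smooth (apx-PWS), for some $L\ge0$, $\delta\ge0$: there is a covering $X\subseteq\cup_{i=1}^kX_i$ and an oracle which, queried at $\bar x\in X$, returns a linear (affine) support function $\tilde l_f(\cdot;\bar x)$ with (i) $f(y)\ge\tilde l_f(y;\bar x)$ for all $y\in X$, and (ii) if $\bar x\in X_i$ then $f(y)-\tilde l_f(y;\bar x)\le\frac L2\|y-\bar x\|^2+\delta$ for all $y\in X_i$. Quadratic growth with modulus $\mu>0$: $f(x)-f^*\ge\frac\mu2\operatorname{dist}^2(x,X^* )$ for all $x\in X$. Algorithm apx-BL$(m,f^*,x^0)$, $m\ge1$: for $t=0,1,2,\dots$, let $X(t)=\{x\in X:\tilde l_f(x;x^{t-i})\le f^*,\ i=0,\dots,m-1\}$ (cuts at the $m$ most recent iterates, as far as they exist) and set $x^{t+1}=\arg\min_{x\in X(t)}\frac12\|x-x^t\|^2$. $l$-matching pair (integer $l\ge1$): a pair $(x^t,x^{t+j})$ with $j\in\{1,\dots,l\}$ such that $x^t$ and $x^{t+j}$ belong to a common piece. An $l$-matching pair sequence is a set of index pairs $\{(l_i,r_i)\}_{i\ge1}$ such that each $(x^{l_i},x^{r_i})$ is an $l$-matching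 pair and $r_i\le l_{i+1}<r_{i+1}$ for all $i\ge1$. Given such a sequence and an iteration limit $N\ge l$, $P(N)=\max\{i:r_i\le N\}$ is the number of pairs completed by iteration $N$, and the statistics are $\bar\kappa(N)=N/P(N)$ (average inter-arrival time) and $\bar\sigma(N)=P(N)\big/\sum_{i=1}^{P(N)}\frac1{r_i-l_i}$ (average length).
   Formalization: In (b), κ(N) is c·σ̄(N)κ̄(N)·max(1, L/μ), as the rate with L/μ fails for μ much larger than L; the second bound holds with the minimum over {1,…,N} only when N ≥ κ(N), otherwise with t = 0 included, as it fails for small N. At least one pair is assumed completed by N. *)

theory Defs
  imports "HOL-Analysis.Analysis" "HOL-Library.Poly_Mapping"
begin

text \<open>
  The constants in the theorem are absolute, hence in particular independent of the dimension
  \<open>n\<close>, so \<open>n\<close> has to be quantified inside the formula. All spaces \<open>\<real>\<^sup>n\<close> are therefore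
  realised inside one inner product space, the finitely supported real sequences, as the subspaces
  of the sequences supported on \<open>{..<n}\<close>.
\<close>

instantiation poly_mapping :: (type, real_vector) real_vector
begin

lift_definition scaleR_poly_mapping :: "real \<Rightarrow> ('a \<Rightarrow>\<^sub>0 'b) \<Rightarrow> ('a \<Rightarrow>\<^sub>0 'b)"
  is "\<lambda>c x i. c *\<^sub>R x i"
  by (rule rev_finite_subset) auto

instance
  by standard (transfer; simp add: fun_eq_iff scaleR_add_right scaleR_add_left)+

end

lemma lookup_scaleR [simp]: "Poly_Mapping.lookup (c *\<^sub>R x) i = c *\<^sub>R Poly_Mapping.lookup x i"
  by transfer simp

instantiation poly_mapping :: (type, real_inner) real_inner
begin

definition inner_poly_mapping :: "('a \<Rightarrow>\<^sub>0 'b) \<Rightarrow> ('a \<Rightarrow>\<^sub>0 'b) \<Rightarrow> real"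
  where "inner_poly_mapping x y =
    (\<Sum>i\<in>Poly_Mapping.keys x. Poly_Mapping.lookup x i \<bullet> Poly_Mapping.lookup y i)"

definition norm_poly_mapping :: "('a \<Rightarrow>\<^sub>0 'b) \<Rightarrow> real"
  where "norm_poly_mapping x = sqrt (x \<bullet> x)"

definition sgn_poly_mapping :: "('a \<Rightarrow>\<^sub>0 'b) \<Rightarrow> ('a \<Rightarrow>\<^sub>0 'b)"
  where "sgn_poly_mapping x = x /\<^sub>R norm x"

definition dist_poly_mapping :: "('a \<Rightarrow>\<^sub>0 'b) \<Rightarrow> ('a \<Rightarrow>\<^sub>0 'b) \<Rightarrow> real"
  where "dist_poly_mapping x y = norm (x - y)"

definition uniformity_poly_mapping :: "(('a \<Rightarrow>\<^sub>0 'b) \<times> ('a \<Rightarrow>\<^sub>0 'b)) filter"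
  where "uniformity_poly_mapping = (INF e\<in>{0<..}. principal {(x, y). dist x y < e})"

definition open_poly_mapping :: "('a \<Rightarrow>\<^sub>0 'b) set \<Rightarrow> bool"
  where "open_poly_mapping U \<longleftrightarrow> (\<forall>x\<in>U. eventually (\<lambda>(x', y). x' = x \<longrightarrow> y \<in> U) uniformity)"

lemma inner_poly_mapping_superset:
  assumes "finite I" "Poly_Mapping.keys x \<subseteq> I"
  shows "x \<bullet> y = (\<Sum>i\<in>I. Poly_Mapping.lookup x i \<bullet> Poly_Mapping.lookup y i)"
  unfolding inner_poly_mapping_def
  by (rule sum.mono_neutral_left) (use assms in \<open>auto simp: in_keys_iff\<close>)

instance
proof
  fix x y z :: "'a \<Rightarrow>\<^sub>0 'b" and r :: real
  let ?I = "Poly_Mapping.keys x \<union> Poly_Mapping.keys y"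
  have I: "finite ?I" by simp
  show "dist x y = norm (x - y)" by (rule dist_poly_mapping_def)
  show "sgn x = x /\<^sub>R norm x" by (rule sgn_poly_mapping_def)
  show "(uniformity :: (('a \<Rightarrow>\<^sub>0 'b) \<times> ('a \<Rightarrow>\<^sub>0 'b)) filter) =
      (INF e\<in>{0<..}. principal {(x, y). dist x y < e})"
    by (rule uniformity_poly_mapping_def)
  show "open U \<longleftrightarrow> (\<forall>x\<in>U. \<forall>\<^sub>F (x', y) in uniformity. x' = x \<longrightarrow> y \<in> U)"
    for U :: "('a \<Rightarrow>\<^sub>0 'b) set"
    by (rule open_poly_mapping_def)
  show "x \<bullet> y = y \<bullet> x"
    using inner_poly_mapping_superset[OF I, of x y] inner_poly_mapping_superset[OF I, of y x]
    by (simp add: inner_commute)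
  have "Poly_Mapping.keys (x + y) \<subseteq> ?I" by (rule keys_add)
  then show "(x + y) \<bullet> z = x \<bullet> z + y \<bullet> z"
    using inner_poly_mapping_superset[OF I, of "x + y" z] inner_poly_mapping_superset[OF I, of x z]
      inner_poly_mapping_superset[OF I, of y z]
    by (simp add: lookup_add inner_add_left sum.distrib)
  have "Poly_Mapping.keys (r *\<^sub>R x) \<subseteq> Poly_Mapping.keys x" by (auto simp: in_keys_iff)
  then show "(r *\<^sub>R x) \<bullet> y = r * (x \<bullet> y)"
    using inner_poly_mapping_superset[of "Poly_Mapping.keys x" "r *\<^sub>R x" y]
      inner_poly_mapping_superset[of "Poly_Mapping.keys x" x y]
    by (simp add: sum_distrib_left)
  show "0 \<le> x \<bullet> x"
    unfolding inner_poly_mapping_def by (simp add: sum_nonneg)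
  show "x \<bullet> x = 0 \<longleftrightarrow> x = 0"
    unfolding inner_poly_mapping_def
    by (subst sum_nonneg_eq_0_iff) (auto simp: in_keys_iff poly_mapping_eq_iff fun_eq_iff)
  show "norm x = sqrt (x \<bullet> x)" by (rule norm_poly_mapping_def)
qed

end

type_synonym vector = "nat \<Rightarrow>\<^sub>0 real"

definition euclid :: "nat \<Rightarrow> vector set"
  where "euclid n = {x. Poly_Mapping.keys x \<subseteq> {..<n}}"

lemma norm_euclid:
  assumes "x \<in> euclid n"
  shows "norm x = sqrt (\<Sum>i<n. (Poly_Mapping.lookup x i)\<^sup>2)"
  using inner_poly_mapping_superset[of "{..<n}" x x] assms
  by (simp add: euclid_def norm_poly_mapping_def power2_eq_square)

text \<open>
  So \<open>euclid n\<close> carries the usual Euclidean metric. It is closed, hence a subset of it is closed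
  in \<open>euclid n\<close> if and only if it is closed in the ambient space.
\<close>
lemma closed_euclid: "closed (euclid n)"
proof -
  have eq: "x \<bullet> Poly_Mapping.single i 1 = Poly_Mapping.lookup x i" for x :: vector and i
    using inner_poly_mapping_superset[of "insert i (Poly_Mapping.keys x)" x "Poly_Mapping.single i 1"]
    by (auto simp: lookup_single when_def if_distrib cong: if_cong)
  have "euclid n = (\<Inter>i\<in>{n..}. {x. x \<bullet> Poly_Mapping.single i 1 = 0})"
    unfolding eq by (auto simp: euclid_def in_keys_iff subset_iff not_less[symmetric])
  moreover have "closed {x :: vector. x \<bullet> Poly_Mapping.single i 1 = 0}" for i
    by (intro closed_Collect_eq continuous_intros)
  ultimately show ?thesis by auto
qed

text \<open>Functions \<open>f : X \<rightarrow> \<real>\<close> are total functions of which only the values on \<open>X\<close> are used.\<close>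

definition opt_value :: "vector set \<Rightarrow> (vector \<Rightarrow> real) \<Rightarrow> real"
  where "opt_value X f = (INF x\<in>X. f x)"

definition minimizers :: "vector set \<Rightarrow> (vector \<Rightarrow> real) \<Rightarrow> vector set"
  where "minimizers X f = {x. is_arg_min f (\<lambda>y. y \<in> X) x}"

definition affine_on :: "nat \<Rightarrow> (vector \<Rightarrow> real) \<Rightarrow> bool"
  where "affine_on n h \<longleftrightarrow> (\<exists>a\<in>euclid n. \<exists>b. \<forall>y\<in>euclid n. h y = a \<bullet> y + b)"

text \<open>
  \<open>lf y z\<close> is the value at \<open>y\<close> of the support function that the oracle returns when queried
  at \<open>z\<close>. The pieces only have to cover \<open>X\<close>; since \<open>f\<close> is defined on \<open>X\<close>, the upper estimate
  concerns the points of \<open>P i \<inter> X\<close>.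
\<close>
definition apx_PWS ::
  "nat \<Rightarrow> vector set \<Rightarrow> (vector \<Rightarrow> real) \<Rightarrow> nat \<Rightarrow> real \<Rightarrow> real \<Rightarrow>
   (nat \<Rightarrow> vector set) \<Rightarrow> (vector \<Rightarrow> vector \<Rightarrow> real) \<Rightarrow> bool"
  where "apx_PWS n X f k L \<delta> P lf \<longleftrightarrow>
    0 \<le> L \<and> 0 \<le> \<delta> \<and> X \<subseteq> (\<Union>i\<in>{1..k}. P i) \<and>
    (\<forall>z\<in>X. affine_on n (\<lambda>y. lf y z) \<and>
      (\<forall>y\<in>X. lf y z \<le> f y) \<and>
      (\<forall>i\<in>{1..k}. z \<in> P i \<longrightarrow>
        (\<forall>y\<in>P i \<inter> X. f y - lf y z \<le> L / 2 * (norm (y - z))\<^sup>2 + \<delta>)))"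

definition quadratic_growth :: "vector set \<Rightarrow> (vector \<Rightarrow> real) \<Rightarrow> real \<Rightarrow> bool"
  where "quadratic_growth X f \<mu> \<longleftrightarrow>
    (\<forall>x\<in>X. \<mu> / 2 * (infdist x (minimizers X f))\<^sup>2 \<le> f x - opt_value X f)"

definition cut_set ::
  "vector set \<Rightarrow> (vector \<Rightarrow> vector \<Rightarrow> real) \<Rightarrow> nat \<Rightarrow> real \<Rightarrow> (nat \<Rightarrow> vector) \<Rightarrow> nat \<Rightarrow> vector set"
  where "cut_set X lf m fs x t = {y\<in>X. \<forall>i<m. i \<le> t \<longrightarrow> lf y (x (t - i)) \<le> fs}"

definition apx_BL ::
  "vector set \<Rightarrow> (vector \<Rightarrow> vector \<Rightarrow> real) \<Rightarrow> nat \<Rightarrow> real \<Rightarrow> vector \<Rightarrow> (nat \<Rightarrow> vector) \<Rightarrow> bool"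
  where "apx_BL X lf m fs x0 x \<longleftrightarrow>
    1 \<le> m \<and> x 0 = x0 \<and>
    (\<forall>t. is_arg_min (\<lambda>y. 1 / 2 * (norm (y - x t))\<^sup>2) (\<lambda>y. y \<in> cut_set X lf m fs x t) (x (Suc t)))"

definition matching_pair :: "nat \<Rightarrow> nat \<Rightarrow> (nat \<Rightarrow> vector set) \<Rightarrow> (nat \<Rightarrow> vector) \<Rightarrow> nat \<Rightarrow> nat \<Rightarrow> bool"
  where "matching_pair k q P x s t \<longleftrightarrow>
    (\<exists>j\<in>{1..q}. t = s + j) \<and> (\<exists>i\<in>{1..k}. x s \<in> P i \<and> x t \<in> P i)"

text \<open>The pairs are indexed from \<open>1\<close>; the values \<open>l 0\<close> and \<open>r 0\<close> are irrelevant.\<close>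
definition matching_pair_seq ::
  "nat \<Rightarrow> nat \<Rightarrow> (nat \<Rightarrow> vector set) \<Rightarrow> (nat \<Rightarrow> vector) \<Rightarrow> (nat \<Rightarrow> nat) \<Rightarrow> (nat \<Rightarrow> nat) \<Rightarrow> bool"
  where "matching_pair_seq k q P x l r \<longleftrightarrow>
    (\<forall>i\<ge>1. matching_pair k q P x (l i) (r i) \<and> r i \<le> l (Suc i) \<and> l (Suc i) < r (Suc i))"

text \<open>
  The following three quantities are meaningful only if at least one pair is completed by
  iteration \<open>N\<close>: otherwise the maximum is over the empty set and there is no average to take.
\<close>
definition pairs_completed :: "(nat \<Rightarrow> nat) \<Rightarrow> nat \<Rightarrow> nat"
  where "pairs_completed r N = Max {i. 1 \<le> i \<and> r i \<le> N}"

definition avg_interarrival :: "(nat \<Rightarrow> nat) \<Rightarrow> nat \<Rightarrow> real"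
  where "avg_interarrival r N = real N / real (pairs_completed r N)"

definition avg_length :: "(nat \<Rightarrow> nat) \<Rightarrow> (nat \<Rightarrow> nat) \<Rightarrow> nat \<Rightarrow> real"
  where "avg_length l r N =
    real (pairs_completed r N) / (\<Sum>i=1..pairs_completed r N. 1 / (real (r i) - real (l i)))"

text \<open>
  The condition number \<open>L / \<mu>\<close> is floored at \<open>1\<close>. Quadratic growth does not force \<open>\<mu> \<le> L\<close> for a
  piecewise smooth function, and for \<open>L\<close> much smaller than \<open>\<mu>\<close> the linear rates are false without
  the floor. The factor \<open>c\<close> is the constant hidden in the \<open>O(1)\<close>.
\<close>
definition eff_cond ::
  "real \<Rightarrow> real \<Rightarrow> real \<Rightarrow> (nat \<Rightarrow> nat) \<Rightarrow> (nat \<Rightarrow> nat) \<Rightarrow> nat \<Rightarrow> real"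
  where "eff_cond c L \<mu> l r N = c * (avg_length l r N * avg_interarrival r N * max 1 (L / \<mu>))"

end

theory Submission
  imports Defs
begin

text \<open>
  Every iterate is the projection of its predecessor onto a convex set that contains all
  minimizers, because a support function never exceeds \<open>f\<close> and so never exceeds the optimal value
  at a minimizer. Pythagoras' inequality for this projection says that each step decreases the
  squared distance to every minimizer by at least the squared step length. By the Cauchy-Schwarz
  inequality, a displacement over \<open>s\<close> iterations then satisfies
  \<open>\<parallel>x\<^sub>t\<^sub>+\<^sub>s - x\<^sub>t\<parallel>\<^sup>2 \<le> s (D\<^sub>t - D\<^sub>t\<^sub>+\<^sub>s)\<close>, where \<open>D\<^sub>t\<close> is the squared distance of \<open>x\<^sub>t\<close> to
  the set of minimizers (\<open>fejer_displacement_le\<close>).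

  Let \<open>(x\<^sub>a, x\<^sub>b)\<close> be a matching pair. Since the method keeps the cut at \<open>x\<^sub>a\<close> for \<open>m \<ge> k\<close>
  iterations, it is still active when \<open>x\<^sub>b\<close> is computed. Hence the support function at \<open>x\<^sub>a\<close> is at
  most the optimal value at \<open>x\<^sub>b\<close>, and approximate smoothness on the common piece gives
  \<open>f x\<^sub>b - f\<^sup>* - \<delta> \<le> L/2 \<parallel>x\<^sub>b - x\<^sub>a\<parallel>\<^sup>2 \<le> L/2 (b - a) (D\<^sub>a - D\<^sub>b)\<close> (\<open>matching_gap_le\<close>).
  Everything else follows from this inequality and the monotonicity of \<open>D\<close>. Throughout, \<open>S\<close> is the
  sum of the reciprocal lengths \<open>1 / (b - a)\<close> of the completed pairs; the product of the two
  statistics is \<open>N / S\<close>.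

  For part (a), divide the inequality by \<open>b - a\<close> and sum over the pairs: the right-hand sides
  telescope, since the pairs do not overlap.

  For part (b), let \<open>K = max 1 (L/\<mu>)\<close>. A nonincreasing quantity \<open>H\<close> with
  \<open>H\<^sub>b \<le> 4 K (b - a) (H\<^sub>a - H\<^sub>b)\<close> for each pair shrinks by the factor
  \<open>exp (- S / (8 K))\<close> (\<open>interlaced_contraction\<close>), and this is at most \<open>(1 + 1/\<kappa>)\<^sup>-\<^sup>N\<close> for
  \<open>\<kappa> = 8 K N / S\<close>. Quadratic growth makes \<open>H = D - 2 \<delta> / \<mu>\<close> such a quantity, which yields the
  distance bound. For the function values, let \<open>v\<close> be the smallest gap. If \<open>v > 2 \<delta>\<close> then at
  least half of each gap \<open>f x\<^sub>b - f\<^sup>*\<close> survives the subtraction of \<open>\<delta>\<close>, and this half dominates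
  both \<open>v/4\<close> and \<open>\<mu>/8 D\<^sub>b\<close> added together, so that \<open>H = D + 2 v / \<mu>\<close> contracts as well. Comparing
  its first and last value gives \<open>v \<le> \<theta> (f x\<^sub>0 - f\<^sup>* + v)\<close> with
  \<open>\<theta> = exp (- S / (8 K))\<close>, and the \<open>v\<close> on the right can be absorbed when \<open>\<kappa> \<le> N\<close>, since then
  \<open>\<theta> \<le> 1/2\<close>. When \<open>\<kappa> > N\<close> the bound is already met by \<open>x\<^sub>0\<close>. The constants are \<open>C = 3\<close> and
  \<open>c = 8\<close>.
\<close>

section \<open>Projections and Fejer monotone sequences\<close>

text \<open>
  At the projection \<open>p\<close>, the directions to \<open>a\<close> and to any point of \<open>S\<close> form an angle of at least
  90 degrees, as otherwise a short move inside \<open>S\<close> would come closer to \<open>a\<close>.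
\<close>
lemma convex_projection_pythagoras:
  fixes p a :: "'a::real_inner"
  assumes "convex S" "p \<in> S" "y \<in> S" and closest: "\<And>z. z \<in> S \<Longrightarrow> norm (p - a) \<le> norm (z - a)"
  shows "(norm (p - y))\<^sup>2 + (norm (p - a))\<^sup>2 \<le> (norm (a - y))\<^sup>2"
proof -
  have "inner (a - p) (y - p) \<le> 0"
  proof (rule ccontr)
    assume "\<not> inner (a - p) (y - p) \<le> 0"
    then obtain u where u: "u > 0" "u \<le> 1" "dist (p + u *\<^sub>R (y - p)) a < dist p a"
      using closer_point_lemma[of a p y] by auto
    have "(1 - u) *\<^sub>R p + u *\<^sub>R y \<in> S"
      using convexD_alt[OF assms(1-3)] u by simp
    then have "p + u *\<^sub>R (y - p) \<in> S"
      by (simp add: algebra_simps)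
    from closest[OF this] have "norm (p - a) \<le> norm (p + u *\<^sub>R (y - p) - a)" .
    with u show False by (simp add: dist_norm)
  qed
  then show ?thesis
    by (simp add: power2_norm_eq_inner inner_commute algebra_simps)
qed

text \<open>
  The infimum need not be attained, as the ambient space need not be complete, so that bounds on
  the squared distance are passed from the points of the set to the infimum.
\<close>
lemma le_mult_infdist_square:
  fixes a :: "'a::metric_space"
  assumes "M \<noteq> {}" "0 \<le> c" and le: "\<And>y. y \<in> M \<Longrightarrow> A \<le> c * (dist a y)\<^sup>2"
  shows "A \<le> c * (infdist a M)\<^sup>2"
proof (cases "0 < A")
  case True
  obtain y where "y \<in> M" using \<open>M \<noteq> {}\<close> by auto
  with le True have "c \<noteq> 0" by fastforce
  then have c: "0 < c" using \<open>0 \<le> c\<close> by simp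
  have "sqrt (A / c) \<le> dist a z" if "z \<in> M" for z
    using le[OF that] c by (intro real_le_lsqrt) (auto simp: field_simps)
  then have "sqrt (A / c) \<le> infdist a M"
    unfolding infdist_notempty[OF \<open>M \<noteq> {}\<close>] by (intro cINF_greatest \<open>M \<noteq> {}\<close>)
  then have "(sqrt (A / c))\<^sup>2 \<le> (infdist a M)\<^sup>2"
    using True c by (intro power_mono) auto
  then show ?thesis using True c by (simp add: field_simps)
next
  case False
  have "0 \<le> c * (infdist a M)\<^sup>2" using \<open>0 \<le> c\<close> by simp
  with False show ?thesis by linarith
qed

text \<open>
  The squared step lengths telescope against the squared distance to a point of \<open>M\<close>, and the
  Cauchy-Schwarz inequality compares the displacement with their sum.
\<close>
lemma fejer_displacement_le:
  fixes x :: "nat \<Rightarrow> 'a::real_inner"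
  assumes "M \<noteq> {}"
    and fejer: "\<And>t y. y \<in> M \<Longrightarrow>
      (norm (x (Suc t) - y))\<^sup>2 + (norm (x (Suc t) - x t))\<^sup>2 \<le> (norm (x t - y))\<^sup>2"
  shows "(norm (x (t + s) - x t))\<^sup>2
    \<le> real s * ((infdist (x t) M)\<^sup>2 - (infdist (x (t + s)) M)\<^sup>2)"
proof -
  let ?step = "\<lambda>i. norm (x (Suc (t + i)) - x (t + i))"
  have "(norm (x (t + s) - x t))\<^sup>2 + real s * (infdist (x (t + s)) M)\<^sup>2
      \<le> real s * (dist (x t) y)\<^sup>2" if y: "y \<in> M" for y
  proof -
    have "x (t + s) - x t = (\<Sum>i<s. x (Suc (t + i)) - x (t + i))"
      by (induction s) (auto simp: algebra_simps)
    then have "norm (x (t + s) - x t) \<le> (\<Sum>i<s. ?step i)"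
      by (metis norm_sum)
    then have "(norm (x (t + s) - x t))\<^sup>2 \<le> (\<Sum>i<s. ?step i)\<^sup>2"
      by (intro power_mono) auto
    also have "\<dots> \<le> (\<Sum>i<s. (?step i)\<^sup>2) * real s"
      using sum_squared_le_sum_of_squares[of ?step "{..<s}"] by simp
    finally have disp: "(norm (x (t + s) - x t))\<^sup>2 \<le> (\<Sum>i<s. (?step i)\<^sup>2) * real s" .
    have "(\<Sum>i<s. (?step i)\<^sup>2) + (norm (x (t + s) - y))\<^sup>2 \<le> (norm (x t - y))\<^sup>2"
    proof (induction s)
      case (Suc s)
      then show ?case using fejer[OF y, of "t + s"] by simp
    qed simp
    moreover have "(infdist (x (t + s)) M)\<^sup>2 \<le> (norm (x (t + s) - y))\<^sup>2"
      using infdist_le[OF y] infdist_nonneg by (intro power_mono) (auto simp: dist_norm)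
    ultimately have "(\<Sum>i<s. (?step i)\<^sup>2) \<le> (norm (x t - y))\<^sup>2 - (infdist (x (t + s)) M)\<^sup>2"
      by linarith
    then have "(\<Sum>i<s. (?step i)\<^sup>2) * real s
        \<le> ((norm (x t - y))\<^sup>2 - (infdist (x (t + s)) M)\<^sup>2) * real s"
      by (intro mult_right_mono) auto
    with disp show ?thesis by (simp add: dist_norm algebra_simps)
  qed
  from le_mult_infdist_square[OF \<open>M \<noteq> {}\<close> _ this] show ?thesis
    by (simp add: algebra_simps)
qed

section \<open>Nonincreasing sequences along interlaced index pairs\<close>

lemma interlaced_sum_le:
  fixes H :: "nat \<Rightarrow> real"
  assumes mono: "antimono H" and interlaced: "\<And>i. 1 \<le> i \<Longrightarrow> r i \<le> l (Suc i)"
    and "p = 0 \<or> r p \<le> t"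
  shows "(\<Sum>i=1..p. H (l i) - H (r i)) \<le> H 0 - H t"
  using assms(3)
proof (induction p arbitrary: t)
  case 0
  then show ?case using antimonoD[OF mono, of 0 t] by simp
next
  case (Suc p)
  have "p = 0 \<or> r p \<le> l (Suc p)" using interlaced[of p] by (cases p) auto
  from Suc.IH[OF this] have "(\<Sum>i=1..p. H (l i) - H (r i)) \<le> H 0 - H (l (Suc p))" .
  moreover have "H t \<le> H (r (Suc p))" using Suc.prems by (intro antimonoD[OF mono]) simp
  ultimately show ?case by simp
qed

lemma exp_half_le_one_plus:
  fixes a :: real
  assumes "0 \<le> a" "a \<le> 1"
  shows "exp (a / 2) \<le> 1 + a"
proof -
  have "a\<^sup>2 \<le> a" using assms by (simp add: power2_eq_square mult_left_le)
  then have "1 + a / 2 + (a / 2)\<^sup>2 \<le> 1 + a" using assms by (simp add: power_divide)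
  with exp_bound[of "a / 2"] assms show ?thesis by simp
qed

text \<open>
  Each pair divides \<open>H\<close> by \<open>1 + a\<close> with \<open>a = 1 / (J (r i - l i)) \<le> 1\<close>, and \<open>1 + a \<ge> exp (a / 2)\<close>
  on this range turns the product into an exponential of the sum. The bound \<open>B\<close> allows \<open>H\<close> to
  become negative, where it no longer contracts but is trivially small.
\<close>
lemma interlaced_contraction:
  fixes H :: "nat \<Rightarrow> real"
  assumes mono: "antimono H"
    and less: "\<And>i. 1 \<le> i \<Longrightarrow> l i < r i" and interlaced: "\<And>i. 1 \<le> i \<Longrightarrow> r i \<le> l (Suc i)"
    and decrease: "\<And>i. \<lbrakk>1 \<le> i; i \<le> p\<rbrakk> \<Longrightarrow>
      H (r i) \<le> J * (real (r i) - real (l i)) * (H (l i) - H (r i))"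
    and "1 \<le> J" "H 0 \<le> B" "0 \<le> B" and "p = 0 \<or> r p \<le> t"
  shows "H t \<le> exp (- (\<Sum>i=1..p. 1 / (real (r i) - real (l i))) / (2 * J)) * B"
  using decrease \<open>p = 0 \<or> r p \<le> t\<close>
proof (induction p arbitrary: t)
  case 0
  then show ?case using antimonoD[OF mono, of 0 t] \<open>H 0 \<le> B\<close> by simp
next
  case (Suc p)
  define s where "s = real (r (Suc p)) - real (l (Suc p))"
  define Q where "Q = (\<Sum>i=1..p. 1 / (real (r i) - real (l i)))"
  define E where "E = exp (- Q / (2 * J))"
  define a where "a = 1 / (J * s)"
  have s: "1 \<le> s" using less[of "Suc p"] by (simp add: s_def)
  then have Js: "1 \<le> J * s" using \<open>1 \<le> J\<close> mult_mono[of 1 J 1 s] by simp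
  then have a: "0 \<le> a" "a \<le> 1" by (simp_all add: a_def)
  have "p = 0 \<or> r p \<le> l (Suc p)" using interlaced[of p] by (cases p) auto
  then have IH: "H (l (Suc p)) \<le> E * B" using Suc.IH[of "l (Suc p)"] Suc.prems(1) by (simp add: E_def Q_def)
  have dec: "H (r (Suc p)) \<le> J * s * (H (l (Suc p)) - H (r (Suc p)))"
    using Suc.prems(1)[of "Suc p"] by (simp add: s_def)
  have "(1 + a) * H (r (Suc p)) \<le> H (l (Suc p))"
  proof -
    have "H (r (Suc p)) / (J * s) \<le> H (l (Suc p)) - H (r (Suc p))"
      using Js dec
      by (subst pos_divide_le_eq) (auto simp: mult_ac)
    then show ?thesis by (simp add: a_def distrib_right)
  qed
  with IH have "H (r (Suc p)) \<le> E * B / (1 + a)"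
    using a by (simp add: pos_le_divide_eq mult.commute)
  also have "\<dots> \<le> E * B / exp (a / 2)"
    using exp_half_le_one_plus[OF a] a \<open>0 \<le> B\<close> by (intro divide_left_mono) (auto simp: E_def)
  also have "\<dots> = E * exp (- (a / 2)) * B"
    unfolding exp_minus by (simp only: divide_inverse mult_ac)
  also have "E * exp (- (a / 2)) = exp (- Q / (2 * J) + - (a / 2))"
    unfolding E_def by (rule exp_add[symmetric])
  also have "- Q / (2 * J) + - (a / 2) = - (Q + 1 / s) / (2 * J)"
    using s \<open>1 \<le> J\<close> by (simp add: a_def field_simps)
  also have "Q + 1 / s = (\<Sum>i=1..Suc p. 1 / (real (r i) - real (l i)))"
    by (simp add: Q_def s_def)
  finally show ?case using antimonoD[OF mono, of "r (Suc p)" t] Suc.prems(2) by linarith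
qed

section \<open>Completed pairs and their statistics\<close>

lemma pairs_completed_bounds:
  assumes less: "\<And>i. 1 \<le> i \<Longrightarrow> l i < r i" and interlaced: "\<And>i. 1 \<le> i \<Longrightarrow> r i \<le> l (Suc i)"
    and "\<exists>i\<ge>1. r i \<le> N"
  shows "1 \<le> pairs_completed r N" "r (pairs_completed r N) \<le> N"
    and "\<lbrakk>1 \<le> i; i \<le> pairs_completed r N\<rbrakk> \<Longrightarrow> r i \<le> N"
proof -
  have r_step: "r i < r (Suc i)" if "1 \<le> i" for i
    using interlaced[OF that] less[of "Suc i"] by simp
  have i_le: "i \<le> r i" if "1 \<le> i" for i
    using that
  proof (induction i rule: nat_induct_at_least)
    case base
    show ?case using less[of 1] by simp
  next
    case (Suc i)
    then show ?case using r_step[of i] by simp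
  qed
  have "{i. 1 \<le> i \<and> r i \<le> N} \<subseteq> {..N}"
  proof
    fix i assume "i \<in> {i. 1 \<le> i \<and> r i \<le> N}"
    then show "i \<in> {..N}" using i_le[of i] by simp
  qed
  then have "finite {i. 1 \<le> i \<and> r i \<le> N}" by (rule finite_subset) simp
  then have "Max {i. 1 \<le> i \<and> r i \<le> N} \<in> {i. 1 \<le> i \<and> r i \<le> N}"
    using assms(3) by (intro Max_in) auto
  then show p: "1 \<le> pairs_completed r N" "r (pairs_completed r N) \<le> N"
    by (simp_all add: pairs_completed_def)
  show "r i \<le> N" if "1 \<le> i" "i \<le> pairs_completed r N"
  proof -
    have "r i \<le> r (pairs_completed r N)"
      using that(2)
    proof (induction rule: dec_induct)
      case (step j)
      have "r j < r (Suc j)" using r_step[of j] step.hyps that(1) by simp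
      then show ?case using step.IH by simp
    qed simp
    with p show ?thesis by simp
  qed
qed

lemma avg_length_times_avg_interarrival:
  assumes "1 \<le> pairs_completed r N"
  shows "avg_length l r N * avg_interarrival r N
    = real N / (\<Sum>i=1..pairs_completed r N. 1 / (real (r i) - real (l i)))"
  using assms by (simp add: avg_length_def avg_interarrival_def)

lemma one_plus_power_le_exp:
  fixes \<kappa> :: real
  assumes "0 < \<kappa>"
  shows "(1 + 1 / \<kappa>) ^ N \<le> exp (real N / \<kappa>)"
proof -
  have "(1 + 1 / \<kappa>) ^ N \<le> exp (1 / \<kappa>) ^ N" using assms by (intro power_mono) auto
  then show ?thesis by (simp add: exp_of_nat_mult[symmetric])
qed

section \<open>Runs of the bundle-level method\<close>

locale apx_BL_run =
  fixes n :: nat and X :: "vector set" and f :: "vector \<Rightarrow> real" and k :: nat and L \<delta> :: real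
    and P :: "nat \<Rightarrow> vector set" and lf :: "vector \<Rightarrow> vector \<Rightarrow> real" and m :: nat
    and x0 :: vector and x :: "nat \<Rightarrow> vector"
  assumes X_euclid: "X \<subseteq> euclid n" and convex_X: "convex X"
    and minimizers_nonempty: "minimizers X f \<noteq> {}"
    and pws: "apx_PWS n X f k L \<delta> P lf"
    and k_le_m: "k \<le> m" and x0_in: "x0 \<in> X"
    and run: "apx_BL X lf m (opt_value X f) x0 x"
begin

abbreviation "fs \<equiv> opt_value X f"
abbreviation "D t \<equiv> (infdist (x t) (minimizers X f))\<^sup>2"

lemma L_nonneg: "0 \<le> L" and \<delta>_nonneg: "0 \<le> \<delta>"
  using pws by (auto simp: apx_PWS_def)

lemma minimizer_in: "y \<in> minimizers X f \<Longrightarrow> y \<in> X"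
  by (simp add: minimizers_def is_arg_min_def)

lemma minimizer_le: "\<lbrakk>y \<in> minimizers X f; z \<in> X\<rbrakk> \<Longrightarrow> f y \<le> f z"
  by (simp add: minimizers_def is_arg_min_linorder)

lemma minimizer_value:
  assumes "y \<in> minimizers X f" shows "f y = fs"
  unfolding opt_value_def
  by (rule sym, rule cInf_eq_minimum) (use assms minimizer_in minimizer_le in auto)

lemma opt_value_le: "z \<in> X \<Longrightarrow> fs \<le> f z"
  using minimizers_nonempty minimizer_value minimizer_le by (metis ex_in_conv)

lemma convex_sublevel_support:
  assumes "z \<in> X" shows "convex {y \<in> X. lf y z \<le> a}"
proof -
  obtain g b where g: "\<And>y. y \<in> X \<Longrightarrow> lf y z = inner g y + b"
    using pws assms X_euclid unfolding apx_PWS_def affine_on_def by blast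
  have "{y \<in> X. lf y z \<le> a} = X \<inter> {y. inner g y \<le> a - b}" using g by auto
  then show ?thesis using convex_X convex_halfspace_le[of g "a - b"] by (simp add: convex_Int)
qed

lemma iterate_in: "x t \<in> X"
proof (cases t)
  case 0
  then show ?thesis using run x0_in by (simp add: apx_BL_def)
next
  case (Suc t')
  then show ?thesis using run by (simp add: apx_BL_def is_arg_min_def cut_set_def)
qed

lemma iterate_0: "x 0 = x0"
  using run by (simp add: apx_BL_def)

lemma Suc_iterate_in_cut_set: "x (Suc t) \<in> cut_set X lf m fs x t"
  using run by (simp add: apx_BL_def is_arg_min_def)

lemma convex_cut_set: "convex (cut_set X lf m fs x t)"
proof -
  have "cut_set X lf m fs x t = X \<inter> (\<Inter>i\<in>{i. i < m \<and> i \<le> t}. {y \<in> X. lf y (x (t - i)) \<le> fs})"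
    by (auto simp: cut_set_def)
  then show ?thesis
    using convex_X convex_sublevel_support iterate_in by (simp add: convex_Int convex_INT)
qed

lemma minimizer_in_cut_set:
  assumes "y \<in> minimizers X f" shows "y \<in> cut_set X lf m fs x t"
proof -
  have "lf y (x i) \<le> f y" for i
    using pws iterate_in[of i] minimizer_in[OF assms] unfolding apx_PWS_def by blast
  then show ?thesis using minimizer_in[OF assms] minimizer_value[OF assms] by (simp add: cut_set_def)
qed

lemma run_displacement_le: "(norm (x (t + s) - x t))\<^sup>2 \<le> real s * (D t - D (t + s))"
proof (rule fejer_displacement_le[OF minimizers_nonempty])
  fix t y assume y: "y \<in> minimizers X f"
  show "(norm (x (Suc t) - y))\<^sup>2 + (norm (x (Suc t) - x t))\<^sup>2 \<le> (norm (x t - y))\<^sup>2"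
  proof (rule convex_projection_pythagoras[OF convex_cut_set[of t]])
    show "norm (x (Suc t) - x t) \<le> norm (z - x t)" if "z \<in> cut_set X lf m fs x t" for z
    proof -
      have "(norm (x (Suc t) - x t))\<^sup>2 \<le> (norm (z - x t))\<^sup>2"
        using run that by (auto simp: apx_BL_def is_arg_min_linorder)
      then show ?thesis by (rule power2_le_imp_le) simp
    qed
  qed (use y Suc_iterate_in_cut_set minimizer_in_cut_set in auto)
qed

lemma antimono_D: "antimono D"
proof (rule decseq_SucI)
  fix t show "D (Suc t) \<le> D t"
    using order_trans[OF zero_le_power2 run_displacement_le[of t 1]] by simp
qed

lemma matching_gap_le:
  assumes "matching_pair k k P x a b"
  shows "f (x b) - fs - \<delta> \<le> L / 2 * ((real b - real a) * (D a - D b))"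
proof -
  obtain j i where j: "1 \<le> j" "j \<le> k" "b = a + j" and i: "i \<in> {1..k}" "x a \<in> P i" "x b \<in> P i"
    using assms by (auto simp: matching_pair_def)
  \<comment> \<open>The set onto which \<open>x b\<close> is projected belongs to iteration \<open>b - 1\<close>, so that the cut at \<open>x a\<close>
      has age \<open>j - 1 < k \<le> m\<close>.\<close>
  have "x (Suc (a + j - 1)) \<in> cut_set X lf m fs x (a + j - 1)" by (rule Suc_iterate_in_cut_set)
  then have "\<forall>i<m. i \<le> a + j - 1 \<longrightarrow> lf (x b) (x (a + j - 1 - i)) \<le> fs"
    using j by (simp add: cut_set_def)
  then have "lf (x b) (x a) \<le> fs"
    using j k_le_m by (auto dest!: spec[of _ "j - 1"])
  moreover have "f (x b) - lf (x b) (x a) \<le> L / 2 * (norm (x b - x a))\<^sup>2 + \<delta>"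
    using pws i iterate_in by (auto simp: apx_PWS_def)
  moreover have "L / 2 * (norm (x b - x a))\<^sup>2 \<le> L / 2 * ((real b - real a) * (D a - D b))"
    using run_displacement_le[of a j] j L_nonneg by (intro mult_left_mono) auto
  ultimately show ?thesis by linarith
qed

end

section \<open>Rates along a matching pair sequence\<close>

locale matched_apx_BL_run = apx_BL_run +
  fixes l r :: "nat \<Rightarrow> nat" and N :: nat
  assumes pairs: "matching_pair_seq k k P x l r" and N_pos: "1 \<le> N"
    and completed: "\<exists>i\<ge>1. r i \<le> N"
begin

abbreviation "p \<equiv> pairs_completed r N"
abbreviation "S \<equiv> \<Sum>i=1..p. 1 / (real (r i) - real (l i))"

lemma pair: "1 \<le> i \<Longrightarrow> matching_pair k k P x (l i) (r i)"
  and interlaced: "1 \<le> i \<Longrightarrow> r i \<le> l (Suc i)"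
  using pairs by (auto simp: matching_pair_seq_def)

lemma pair_less: "1 \<le> i \<Longrightarrow> l i < r i"
  using pair[of i] by (auto simp: matching_pair_def)

lemma p_pos: "1 \<le> p" and r_p_le: "r p \<le> N"
  using pairs_completed_bounds(1,2)[of l r N] pair_less interlaced completed by auto

lemma r_le: "\<lbrakk>1 \<le> i; i \<le> p\<rbrakk> \<Longrightarrow> r i \<le> N"
  using pairs_completed_bounds(3)[of l r N i] pair_less interlaced completed by auto

lemma S_pos: "0 < S"
  using p_pos by (intro sum_pos) (auto simp: pair_less)

abbreviation "min_gap \<equiv> (MIN t\<in>{1..N}. f (x t)) - fs"

lemma min_gap_le: "\<lbrakk>1 \<le> t; t \<le> N\<rbrakk> \<Longrightarrow> min_gap \<le> f (x t) - fs"
  by (auto intro!: Min_le)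

lemma min_gap_le_pair: "\<lbrakk>1 \<le> i; i \<le> p\<rbrakk> \<Longrightarrow> min_gap \<le> f (x (r i)) - fs"
  using r_le[of i] pair_less[of i] by (intro min_gap_le) auto

lemma sublinear_rate:
  "min_gap \<le> L * avg_length l r N * avg_interarrival r N / (2 * real N) * D 0 + \<delta>"
proof -
  have "(min_gap - \<delta>) * S = (\<Sum>i=1..p. (min_gap - \<delta>) * (1 / (real (r i) - real (l i))))"
    by (rule sum_distrib_left)
  also have "\<dots> \<le> (\<Sum>i=1..p. L / 2 * (D (l i) - D (r i)))"
  proof (rule sum_mono)
    fix i assume "i \<in> {1..p}"
    then have i: "1 \<le> i" "i \<le> p" by auto
    have "min_gap - \<delta> \<le> L / 2 * ((real (r i) - real (l i)) * (D (l i) - D (r i)))"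
      using matching_gap_le[OF pair[OF i(1)]] min_gap_le_pair[OF i] by linarith
    then show "(min_gap - \<delta>) * (1 / (real (r i) - real (l i))) \<le> L / 2 * (D (l i) - D (r i))"
      using pair_less[OF i(1)] by (simp add: pos_divide_le_eq mult_ac)
  qed
  also have "\<dots> = L / 2 * (\<Sum>i=1..p. D (l i) - D (r i))"
    by (rule sum_distrib_left[symmetric])
  also have "\<dots> \<le> L / 2 * D 0"
  proof (rule mult_left_mono)
    have "(\<Sum>i=1..p. D (l i) - D (r i)) \<le> D 0 - D N"
      by (rule interlaced_sum_le[OF antimono_D]) (use interlaced r_p_le in auto)
    then show "(\<Sum>i=1..p. D (l i) - D (r i)) \<le> D 0"
      using zero_le_power2[of "infdist (x N) (minimizers X f)"] by linarith
  qed (simp add: L_nonneg)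
  finally have "(min_gap - \<delta>) * S \<le> L / 2 * D 0" .
  then have "min_gap - \<delta> \<le> L / 2 * D 0 / S"
    using S_pos by (simp only: pos_le_divide_eq)
  also have "\<dots> = L * (real N / S) / (2 * real N) * D 0"
    using N_pos S_pos by (simp add: field_simps)
  also have "\<dots> = L * avg_length l r N * avg_interarrival r N / (2 * real N) * D 0"
    using avg_length_times_avg_interarrival[OF p_pos, of l] by (simp add: mult.assoc)
  finally show ?thesis by linarith
qed

context
  fixes \<mu> :: real
  assumes \<mu>_pos: "0 < \<mu>" and growth: "quadratic_growth X f \<mu>"
begin

abbreviation "K \<equiv> max 1 (L / \<mu>)"
abbreviation "\<kappa> \<equiv> eff_cond 8 L \<mu> l r N"
abbreviation "\<theta> \<equiv> exp (- S / (2 * (4 * K)))"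

lemma growth_D: "\<mu> / 2 * D t \<le> f (x t) - fs"
  using growth iterate_in by (simp add: quadratic_growth_def)

lemma matching_gap_le_cond:
  assumes "1 \<le> i"
  shows "max 0 (f (x (r i)) - fs - \<delta>)
    \<le> \<mu> / 2 * (K * (real (r i) - real (l i)) * (D (l i) - D (r i)))"
proof -
  let ?d = "(real (r i) - real (l i)) * (D (l i) - D (r i))"
  have "L \<le> \<mu> * K" using \<mu>_pos by (simp add: max_def field_simps)
  moreover have d: "0 \<le> ?d"
    using pair_less[OF assms] antimonoD[OF antimono_D, of "l i" "r i"]
    by (intro mult_nonneg_nonneg) auto
  ultimately have "L / 2 * ?d \<le> \<mu> * K / 2 * ?d"
    by (intro mult_right_mono) auto
  moreover have "0 \<le> \<mu> * K / 2 * ?d"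
    using \<mu>_pos by (intro mult_nonneg_nonneg[OF _ d]) auto
  ultimately have "max 0 (f (x (r i)) - fs - \<delta>) \<le> \<mu> * K / 2 * ?d"
    using matching_gap_le[OF pair[OF assms]] by linarith
  then show ?thesis by (simp add: mult_ac)
qed

text \<open>
  Two shifts serve the two bounds: \<open>a = - 2 \<delta> / \<mu>\<close> gives the distance and \<open>a = 2 v / \<mu>\<close>, with
  the smallest gap \<open>v\<close>, the function values. The second needs the factor \<open>4\<close>. The truncation at
  \<open>0\<close> lets the first share it, since \<open>4\<close> times a negative number is smaller than that number.
\<close>
lemma shifted_D_contraction:
  assumes "\<And>i. \<lbrakk>1 \<le> i; i \<le> p\<rbrakk> \<Longrightarrow>
      \<mu> / 2 * (D (r i) + a) \<le> 4 * max 0 (f (x (r i)) - fs - \<delta>)"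
    and "D 0 + a \<le> B" "0 \<le> B"
  shows "D N + a \<le> \<theta> * B"
proof (rule interlaced_contraction[where H = \<open>\<lambda>t. D t + a\<close>])
  show "antimono (\<lambda>t. D t + a)"
    using antimono_D by (auto simp: monotone_def)
  show "D (r i) + a \<le> 4 * K * (real (r i) - real (l i)) * (D (l i) + a - (D (r i) + a))"
    if "1 \<le> i" "i \<le> p" for i
  proof -
    have "\<mu> / 2 * (D (r i) + a) \<le> 4 * max 0 (f (x (r i)) - fs - \<delta>)"
      by (rule assms(1)[OF that])
    also have "\<dots> \<le> 4 * (\<mu> / 2 * (K * (real (r i) - real (l i)) * (D (l i) - D (r i))))"
      by (rule mult_left_mono[OF matching_gap_le_cond[OF that(1)]]) simp
    also have "\<dots> = \<mu> / 2 * (4 * K * (real (r i) - real (l i)) * (D (l i) - D (r i)))"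
      by (simp add: mult_ac)
    finally show ?thesis using \<mu>_pos by simp
  qed
qed (use assms pair_less interlaced r_p_le in auto)

lemma \<kappa>_eq: "\<kappa> = 8 * K * real N / S"
  using avg_length_times_avg_interarrival[OF p_pos, of l] by (simp add: eff_cond_def)

lemma \<kappa>_pos: "0 < \<kappa>"
  unfolding \<kappa>_eq using N_pos S_pos by (intro divide_pos_pos mult_pos_pos) auto

lemma N_over_\<kappa>: "real N / \<kappa> = S / (2 * (4 * K))"
  unfolding \<kappa>_eq using N_pos S_pos by (simp add: field_simps)

lemma \<theta>_le: "\<theta> \<le> (1 + 1 / \<kappa>) powi (- int N)"
proof -
  have "\<theta> = inverse (exp (real N / \<kappa>))" by (simp add: N_over_\<kappa> exp_minus)
  also have "\<dots> \<le> inverse ((1 + 1 / \<kappa>) ^ N)"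
    using one_plus_power_le_exp[OF \<kappa>_pos] \<kappa>_pos by (intro le_imp_inverse_le zero_less_power add_pos_pos) auto
  finally show ?thesis by (simp add: power_int_minus)
qed

lemma distance_rate:
  "D N \<le> (1 + 1 / \<kappa>) powi (- int N) * 3 * D 0 + 4 * \<delta> / \<mu>"
proof -
  have shift: "\<mu> / 2 * (D t + (- 2 * \<delta> / \<mu>)) \<le> f (x t) - fs - \<delta>" for t
    using growth_D[of t] \<mu>_pos by (simp add: algebra_simps)
  have D0: "0 \<le> D 0" by simp
  have "D N + (- 2 * \<delta> / \<mu>) \<le> \<theta> * D 0"
  proof (rule shifted_D_contraction)
    show "\<mu> / 2 * (D (r i) + (- 2 * \<delta> / \<mu>)) \<le> 4 * max 0 (f (x (r i)) - fs - \<delta>)" for i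
      using shift[of "r i"] by (simp add: max_def)
    show "D 0 + (- 2 * \<delta> / \<mu>) \<le> D 0" using \<delta>_nonneg \<mu>_pos by simp
  qed (rule D0)
  moreover have "\<theta> * D 0 \<le> (1 + 1 / \<kappa>) powi (- int N) * D 0"
    using \<theta>_le D0 by (rule mult_right_mono)
  moreover have "0 \<le> (1 + 1 / \<kappa>) powi (- int N) * D 0"
    using \<kappa>_pos by (intro mult_nonneg_nonneg zero_le_power_int) auto
  moreover have "0 \<le> \<delta> / \<mu>" using \<delta>_nonneg \<mu>_pos by simp
  ultimately show ?thesis by simp
qed

lemma value_rate:
  assumes "\<kappa> \<le> real N"
  shows "min_gap \<le> (1 + 1 / \<kappa>) powi (- int N) * 3 * (f x0 - fs) + 2 * exp 1 * \<delta>"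
proof -
  have f0: "0 \<le> f x0 - fs" using opt_value_le[OF x0_in] by simp
  have q: "0 \<le> (1 + 1 / \<kappa>) powi (- int N)"
    using \<kappa>_pos by (intro zero_le_power_int) auto
  show ?thesis
  proof (cases "min_gap \<le> 2 * \<delta>")
    case True
    have "2 * \<delta> \<le> 2 * exp 1 * \<delta>"
      using \<delta>_nonneg exp_ge_add_one_self[of 1] by (intro mult_right_mono) auto
    moreover have "0 \<le> (1 + 1 / \<kappa>) powi (- int N) * 3 * (f x0 - fs)"
      using q f0 by simp
    ultimately show ?thesis using True by linarith
  next
    case False
    then have gap: "2 * \<delta> < min_gap" by simp
    then have gap_nonneg: "0 \<le> min_gap" using \<delta>_nonneg by linarith
    have "D N + 2 * min_gap / \<mu> \<le> \<theta> * (D 0 + 2 * min_gap / \<mu>)"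
    proof (rule shifted_D_contraction)
      show "\<mu> / 2 * (D (r i) + 2 * min_gap / \<mu>) \<le> 4 * max 0 (f (x (r i)) - fs - \<delta>)"
        if i: "1 \<le> i" "i \<le> p" for i
      proof -
        have "\<mu> / 2 * (D (r i) + 2 * min_gap / \<mu>) = \<mu> / 2 * D (r i) + min_gap"
          using \<mu>_pos by (simp add: field_simps)
        also have "\<dots> \<le> 2 * (f (x (r i)) - fs)"
          using add_mono[OF growth_D min_gap_le_pair[OF i]] by (simp only: mult_2)
        also have "\<dots> \<le> 4 * (f (x (r i)) - fs - \<delta>)"
          using min_gap_le_pair[OF i] gap by argo
        finally show ?thesis by (simp add: max_def)
      qed
      show "0 \<le> D 0 + 2 * min_gap / \<mu>"
        using gap_nonneg \<mu>_pos by (intro add_nonneg_nonneg divide_nonneg_pos) auto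
    qed simp
    then have decrease: "2 * min_gap / \<mu> \<le> \<theta> * (D 0 + 2 * min_gap / \<mu>)"
      using zero_le_power2[of "infdist (x N) (minimizers X f)"] by linarith
    have "min_gap = \<mu> / 2 * (2 * min_gap / \<mu>)" using \<mu>_pos by simp
    also have "\<dots> \<le> \<mu> / 2 * (\<theta> * (D 0 + 2 * min_gap / \<mu>))"
      using \<mu>_pos by (intro mult_left_mono[OF decrease]) simp
    also have "\<dots> = \<theta> * (\<mu> / 2 * D 0 + min_gap)"
      using \<mu>_pos by (simp add: field_simps)
    also have "\<dots> \<le> \<theta> * ((f x0 - fs) + min_gap)"
      using growth_D[of 0] by (intro mult_left_mono) (auto simp: iterate_0)
    also have "\<dots> = \<theta> * (f x0 - fs) + \<theta> * min_gap" by (rule distrib_left)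
    finally have "min_gap \<le> \<theta> * (f x0 - fs) + \<theta> * min_gap" .
    moreover have "\<theta> * min_gap \<le> 1 / 2 * min_gap"
    proof (rule mult_right_mono[OF _ gap_nonneg])
      have "1 \<le> real N / \<kappa>" using assms \<kappa>_pos by simp
      then have "2 \<le> exp (real N / \<kappa>)"
        using exp_ge_add_one_self[of "real N / \<kappa>"] by linarith
      then have "inverse (exp (real N / \<kappa>)) \<le> inverse 2" by (intro le_imp_inverse_le) auto
      then show "\<theta> \<le> 1 / 2" by (simp add: N_over_\<kappa> exp_minus)
    qed
    moreover have "\<theta> * (f x0 - fs) \<le> (1 + 1 / \<kappa>) powi (- int N) * (f x0 - fs)"
      using \<theta>_le f0 by (rule mult_right_mono)
    moreover have "0 \<le> (1 + 1 / \<kappa>) powi (- int N) * (f x0 - fs)"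
      using q f0 by simp
    moreover have "0 \<le> 2 * exp 1 * \<delta>" using \<delta>_nonneg by simp
    moreover have "v \<le> w * 3 * g + e"
      if "v \<le> a + b" "b \<le> 1 / 2 * v" "a \<le> w * g" "0 \<le> w * g" "0 \<le> e"
      for v w g e a b :: real
    proof -
      have "v \<le> 2 * (w * g)" using that by linarith
      then show ?thesis using that by simp
    qed
    ultimately show ?thesis by blast
  qed
qed

text \<open>
  For \<open>N < \<kappa>\<close> the starting point itself satisfies the bound, because then
  \<open>(1 + 1/\<kappa>)\<^sup>N \<le> e \<le> 3\<close>, so that the factor in front of \<open>f x0 - fs\<close> is at least \<open>1\<close>.
\<close>
lemma value_rate_with_start:
  "(MIN t\<in>{0..N}. f (x t)) - fs
    \<le> (1 + 1 / \<kappa>) powi (- int N) * 3 * (f x0 - fs) + 2 * exp 1 * \<delta>"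
proof (cases "\<kappa> \<le> real N")
  case True
  have "(MIN t\<in>{0..N}. f (x t)) \<le> (MIN t\<in>{1..N}. f (x t))"
    using N_pos by (intro Min_antimono image_mono) auto
  with value_rate[OF True] show ?thesis by linarith
next
  case False
  have f0: "0 \<le> f x0 - fs" using opt_value_le[OF x0_in] by simp
  have "(1 + 1 / \<kappa>) ^ N \<le> exp (real N / \<kappa>)" by (rule one_plus_power_le_exp[OF \<kappa>_pos])
  also have "\<dots> \<le> exp 1" using False \<kappa>_pos by simp
  also have "\<dots> \<le> 3" by (rule exp_le)
  finally have "1 \<le> (1 + 1 / \<kappa>) powi (- int N) * 3"
    using \<kappa>_pos by (simp add: power_int_minus field_simps)
  from mult_right_mono[OF this f0]
  have "f x0 - fs \<le> (1 + 1 / \<kappa>) powi (- int N) * 3 * (f x0 - fs)" by simp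
  moreover have "(MIN t\<in>{0..N}. f (x t)) \<le> f x0"
    using iterate_0 by (intro Min_le) force+
  moreover have "0 \<le> 2 * exp 1 * \<delta>" using \<delta>_nonneg by simp
  ultimately show ?thesis by linarith
qed

end

end

theorem theorem3p1:
  shows "\<exists>C>0. \<exists>c>0.
    \<forall>(n::nat) (X::vector set) (f::vector \<Rightarrow> real) (k::nat) (L::real) (\<delta>::real)
      (P::nat \<Rightarrow> vector set) (lf::vector \<Rightarrow> vector \<Rightarrow> real) (m::nat)
      (x0::vector) (x::nat \<Rightarrow> vector) (l::nat \<Rightarrow> nat) (r::nat \<Rightarrow> nat) (N::nat).
      X \<subseteq> euclid n \<and> closed X \<and> convex X \<and>
      (\<exists>M. M-lipschitz_on X f) \<and> bdd_below (f ` X) \<and> minimizers X f \<noteq> {} \<and>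
      convex_on X f \<and> apx_PWS n X f k L \<delta> P lf \<and>
      k \<le> m \<and> x0 \<in> X \<and> apx_BL X lf m (opt_value X f) x0 x \<and>
      matching_pair_seq k k P x l r \<and>
      1 \<le> N \<and> (\<exists>i\<ge>1. r i \<le> N)
    \<longrightarrow>
      (MIN t\<in>{1..N}. f (x t)) - opt_value X f
        \<le> L * avg_length l r N * avg_interarrival r N / (2 * real N)
            * (infdist x0 (minimizers X f))\<^sup>2 + \<delta> \<and>
      (\<forall>\<mu>>0. quadratic_growth X f \<mu> \<longrightarrow>
        (let \<kappa> = eff_cond c L \<mu> l r N in
          (infdist (x N) (minimizers X f))\<^sup>2
            \<le> (1 + 1 / \<kappa>) powi (- int N) * C * (infdist x0 (minimizers X f))\<^sup>2 + 4 * \<delta> / \<mu> \<and>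
          (MIN t\<in>{0..N}. f (x t)) - opt_value X f
            \<le> (1 + 1 / \<kappa>) powi (- int N) * C * (f x0 - opt_value X f) + 2 * exp 1 * \<delta> \<and>
          (\<kappa> \<le> real N \<longrightarrow>
            (MIN t\<in>{1..N}. f (x t)) - opt_value X f
              \<le> (1 + 1 / \<kappa>) powi (- int N) * C * (f x0 - opt_value X f) + 2 * exp 1 * \<delta>)))"
proof (rule exI[of _ 3], rule conjI, simp, rule exI[of _ 8], rule conjI, simp,
    intro allI impI, elim conjE)
  fix n :: nat and X :: "vector set" and f :: "vector \<Rightarrow> real" and k :: nat and L \<delta> :: real
    and P :: "nat \<Rightarrow> vector set" and lf :: "vector \<Rightarrow> vector \<Rightarrow> real" and m :: nat
    and x0 :: vector and x :: "nat \<Rightarrow> vector" and l r :: "nat \<Rightarrow> nat" and N :: nat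
  assume "X \<subseteq> euclid n" "convex X" "minimizers X f \<noteq> {}" "apx_PWS n X f k L \<delta> P lf"
    "k \<le> m" "x0 \<in> X" "apx_BL X lf m (opt_value X f) x0 x"
    "matching_pair_seq k k P x l r" "1 \<le> N" "\<exists>i\<ge>1. r i \<le> N"
  then interpret matched_apx_BL_run n X f k L \<delta> P lf m x0 x l r N
    by unfold_locales
  show "(MIN t\<in>{1..N}. f (x t)) - opt_value X f
        \<le> L * avg_length l r N * avg_interarrival r N / (2 * real N)
            * (infdist x0 (minimizers X f))\<^sup>2 + \<delta> \<and>
      (\<forall>\<mu>>0. quadratic_growth X f \<mu> \<longrightarrow>
        (let \<kappa> = eff_cond 8 L \<mu> l r N in
          (infdist (x N) (minimizers X f))\<^sup>2
            \<le> (1 + 1 / \<kappa>) powi (- int N) * 3 * (infdist x0 (minimizers X f))\<^sup>2 + 4 * \<delta> / \<mu> \<and>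
          (MIN t\<in>{0..N}. f (x t)) - opt_value X f
            \<le> (1 + 1 / \<kappa>) powi (- int N) * 3 * (f x0 - opt_value X f) + 2 * exp 1 * \<delta> \<and>
          (\<kappa> \<le> real N \<longrightarrow>
            (MIN t\<in>{1..N}. f (x t)) - opt_value X f
              \<le> (1 + 1 / \<kappa>) powi (- int N) * 3 * (f x0 - opt_value X f) + 2 * exp 1 * \<delta>)))"
    unfolding Let_def
    using sublinear_rate distance_rate value_rate value_rate_with_start by (simp only: iterate_0) blast
qed

end
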